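(* Let $\mathfrak{g}=\mathbb{R}e_0\ltimes_{S+A}\mathbb{R}^{d-1}$ be a $d$-dimensional almost abelian Lie algebra equipped with an inner product $\langle\cdot,\cdot\rangle$, where $e_0$ is a unit vector orthogonal to the abelian ideal $\mathfrak{u}=\mathbb{R}^{d-1}$ and $\operatorname{ad}_{e_0}|_{\mathfrak{u}}=S+A$, with $S$ and $A$ the symmetric and skew-symmetric parts of $\operatorname{ad}_{e_0}|_{\mathfrak{u}}$ with respect to $\langle\cdot,\cdot\rangle$, respectively. Then $(\mathfrak{g},\langle\cdot,\cdot\rangle)$ admits a strict Killing vector and a strict CKY $(d-1)$-form (which is $*$-Killing) if and only if $$\operatorname{Ker}A\cap\operatorname{Ker}S\subsetneq\operatorname{Ker}(A+S).$$ In this case, any $z\in\operatorname{Ker}(A+S)\setminus(\operatorname{Ker}A\cap\operatorname{Ker}S)$ is a strict Killing vector.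
   Context: $\mathfrak{g}=\mathbb{R}e_0\ltimes_M\mathfrak{u}$ denotes the real Lie algebra $\mathbb{R}e_0\oplus\mathfrak{u}$ with $\mathfrak{u}$ an abelian ideal and $[e_0,u]=Mu$ for $u\in\mathfrak{u}$. The Levi-Civita connection is given on $\mathfrak{g}$ by $2\langle\nabla_xy,z\rangle=\langle[x,y],z\rangle-\langle[y,z],x\rangle+\langle[z,x],y\rangle$, and on $p$-forms by $(\nabla_x\omega)(x_1,\dots,x_p)=-\sum_i\omega(x_1,\dots,\nabla_xx_i,\dots,x_p)$. The exterior derivative is $d\omega(x_0,\dots,x_p)=\sum_{i<j}(-1)^{i+j}\omega([x_i,x_j],x_0,\dots,\hat{x}_i,\dots,\hat{x}_j,\dots,x_p)$, and the codifferential is $d^*\omega=-\sum_i e_i\lrcorner\nabla_{e_i}\omega$ for any orthonormal basis $\{e_i\}$ of $\mathfrak{g}$. For $x\in\mathfrak{g}$, $x^*=\langle x,\cdot\rangle$. With $d=\dim\mathfrak{g}$ a $p$-form $\omega$ is conformal Killing (CKY) if for all $x\in\mathfrak{g}$ $$\nabla_x\omega=\frac{1}{p+1}\,x\lrcorner d\omega-\frac{1}{d-p+1}\,x^*\wedge d^*\omega.$$ It is Killing (KY) if $\nabla_x\omega=\frac{1}{p+1}x\lrcorner d\omega$ for all $x\in\mathfrak{g}$, $*$-Killing if it is CKY and $d\omega=0$, and parallel if $\nabla_x\omega=0$ for all $x$. A strict CKY form is a CKY form which is not KY. A Killing vector is $z\in\mathfrak{g}$ whose dual $1$-form $\langle z,\cdot\rangle$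 is Killing; it is strict if it is Killing and its dual $1$-form is not parallel. *)

theory Defs
  imports "HOL-Analysis.Analysis"
begin

section \<open>Metric Lie algebras\<close>

text \<open>A \<open>d\<close>-dimensional real Lie algebra with an inner product is a type of class
  \<^class>\<open>euclidean_space\<close> with a bracket on it; its dimension \<open>d\<close> is \<open>DIM('a)\<close>.\<close>

definition lie_bracket :: "('a::real_vector \<Rightarrow> 'a \<Rightarrow> 'a) \<Rightarrow> bool" where
  "lie_bracket br \<longleftrightarrow>
     bilinear br \<and> (\<forall>x. br x x = 0) \<and>
     (\<forall>x y z. br x (br y z) + br y (br z x) + br z (br x y) = 0)"

definition endo_on :: "'a::real_vector set \<Rightarrow> ('a \<Rightarrow> 'a) \<Rightarrow> bool" where
  "endo_on U f \<longleftrightarrow>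
     (\<forall>x\<in>U. f x \<in> U) \<and>
     (\<forall>x\<in>U. \<forall>y\<in>U. f (x + y) = f x + f y) \<and>
     (\<forall>c. \<forall>x\<in>U. f (c *\<^sub>R x) = c *\<^sub>R f x)"

definition symmetric_on :: "'a::real_inner set \<Rightarrow> ('a \<Rightarrow> 'a) \<Rightarrow> bool" where
  "symmetric_on U f \<longleftrightarrow> endo_on U f \<and> (\<forall>x\<in>U. \<forall>y\<in>U. f x \<bullet> y = x \<bullet> f y)"

definition skew_on :: "'a::real_inner set \<Rightarrow> ('a \<Rightarrow> 'a) \<Rightarrow> bool" where
  "skew_on U f \<longleftrightarrow> endo_on U f \<and> (\<forall>x\<in>U. \<forall>y\<in>U. f x \<bullet> y = - (x \<bullet> f y))"

definition ker_on :: "'a::real_vector set \<Rightarrow> ('a \<Rightarrow> 'a) \<Rightarrow> 'a set" where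
  "ker_on U f = {x \<in> U. f x = 0}"

text \<open>\<open>almost_abelian br e\<^sub>0 U M\<close>: the Lie algebra is \<open>\<real>e\<^sub>0 \<ltimes>\<^sub>M U\<close>.\<close>

definition almost_abelian ::
    "('a::real_vector \<Rightarrow> 'a \<Rightarrow> 'a) \<Rightarrow> 'a \<Rightarrow> 'a set \<Rightarrow> ('a \<Rightarrow> 'a) \<Rightarrow> bool" where
  "almost_abelian br e\<^sub>0 U M \<longleftrightarrow>
     lie_bracket br \<and> subspace U \<and> e\<^sub>0 \<notin> U \<and> span (insert e\<^sub>0 U) = UNIV \<and>
     (\<forall>x. \<forall>u\<in>U. br x u \<in> U) \<and>
     (\<forall>u\<in>U. \<forall>v\<in>U. br u v = 0) \<and>
     endo_on U M \<and> (\<forall>u\<in>U. br e\<^sub>0 u = M u)"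

definition nabla :: "('a::euclidean_space \<Rightarrow> 'a \<Rightarrow> 'a) \<Rightarrow> 'a \<Rightarrow> 'a \<Rightarrow> 'a" where
  "nabla br x y =
     (THE v. \<forall>z. 2 * (v \<bullet> z) = br x y \<bullet> z - br y z \<bullet> x + br z x \<bullet> y)"

lemma nabla_koszul:
  assumes "bilinear br"
  shows "2 * (nabla br x y \<bullet> z) = br x y \<bullet> z - br y z \<bullet> x + br z x \<bullet> y"
proof -
  define f where "f z = (br x y \<bullet> z - br y z \<bullet> x + br z x \<bullet> y) / 2" for z
  have "linear f"
    unfolding f_def
    by (rule linearI)
       (simp_all add: inner_add_right inner_add_left bilinear_radd[OF assms]
         bilinear_ladd[OF assms] bilinear_rmul[OF assms] bilinear_lmul[OF assms] field_simps)
  define w where "w = (\<Sum>b\<in>Basis. f b *\<^sub>R b)"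
  have w: "w \<bullet> z = f z" for z
  proof -
    have "f z = f (\<Sum>b\<in>Basis. (z \<bullet> b) *\<^sub>R b)"
      by (simp add: euclidean_representation)
    also have "\<dots> = (\<Sum>b\<in>Basis. (z \<bullet> b) * f b)"
      using \<open>linear f\<close> by (simp add: linear_sum linear_cmul)
    also have "\<dots> = w \<bullet> z"
      unfolding w_def inner_sum_left
      by (intro sum.cong) (auto simp: inner_commute mult.commute)
    finally show ?thesis by simp
  qed
  let ?P = "\<lambda>v. \<forall>z. 2 * (v \<bullet> z) = br x y \<bullet> z - br y z \<bullet> x + br z x \<bullet> y"
  have "?P w"
    by (simp add: w f_def)
  moreover have "v = w" if "?P v" for v
  proof -
    have "v \<bullet> z = w \<bullet> z" for z
      using spec[OF that, of z] by (simp add: w f_def)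
    then show ?thesis
      by (intro iffD1[OF vector_eq_rdot]) simp
  qed
  ultimately have "?P (nabla br x y)"
    unfolding nabla_def by (rule theI)
  then show ?thesis
    by blast
qed


section \<open>Left-invariant differential forms\<close>

text \<open>A \<open>p\<close>-form is a function on lists of arguments, of which only the values on lists of
  length \<open>p\<close> are relevant; accordingly, equations between \<open>p\<close>-forms are required only on lists
  of length \<open>p\<close>. With this encoding, \<open>x \<lrcorner> \<omega>\<close> is \<open>\<lambda>xs. \<omega> (x # xs)\<close>, and a
  list with the entries at positions \<open>i\<close> and \<open>j\<close> removed is \<open>nths xs (- {i, j})\<close>.\<close>

type_synonym 'a form = "'a list \<Rightarrow> real"

definition is_form :: "nat \<Rightarrow> 'a::real_vector form \<Rightarrow> bool" where
  "is_form p \<omega> \<longleftrightarrow>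
     (\<forall>xs i. length xs = p \<and> i < p \<longrightarrow> linear (\<lambda>x. \<omega> (xs[i := x]))) \<and>
     (\<forall>xs i j. length xs = p \<and> i < j \<and> j < p \<and> xs ! i = xs ! j \<longrightarrow> \<omega> xs = 0)"

definition interior_product :: "'a \<Rightarrow> 'a form \<Rightarrow> 'a form" where
  "interior_product x \<omega> = (\<lambda>xs. \<omega> (x # xs))"

definition dual_form :: "'a::real_inner \<Rightarrow> 'a form" where
  "dual_form x = (\<lambda>ys. x \<bullet> hd ys)"

text \<open>The product \<open>x\<^sup>* \<and> \<eta>\<close> of a 1-form with a form. There is no factorial
  normalisation, so that \<open>d\<omega> = \<Sum>\<^sub>i e\<^sub>i\<^sup>* \<and> \<nabla>\<^bsub>e\<^sub>i\<^esub> \<omega>\<close> for the \<open>d\<close> below.\<close>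

definition wedge_dual :: "'a::real_inner \<Rightarrow> 'a form \<Rightarrow> 'a form" where
  "wedge_dual x \<eta> =
     (\<lambda>ys. \<Sum>i<length ys. (- 1) ^ i * (x \<bullet> ys ! i) * \<eta> (nths ys (- {i})))"

definition nabla_form ::
    "('a::euclidean_space \<Rightarrow> 'a \<Rightarrow> 'a) \<Rightarrow> 'a \<Rightarrow> 'a form \<Rightarrow> 'a form" where
  "nabla_form br x \<omega> =
     (\<lambda>xs. - (\<Sum>i<length xs. \<omega> (xs[i := nabla br x (xs ! i)])))"

definition ext_deriv :: "('a \<Rightarrow> 'a \<Rightarrow> 'a) \<Rightarrow> 'a form \<Rightarrow> 'a form" where
  "ext_deriv br \<omega> =
     (\<lambda>xs. \<Sum>j<length xs. \<Sum>i<j.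
        (- 1) ^ (i + j) * \<omega> (br (xs ! i) (xs ! j) # nths xs (- {i, j})))"

text \<open>The codifferential does not depend on the orthonormal basis
  (\<open>codiff_orthonormal\<close> below); the standard one is used in the definition.\<close>

definition codiff :: "('a::euclidean_space \<Rightarrow> 'a \<Rightarrow> 'a) \<Rightarrow> 'a form \<Rightarrow> 'a form" where
  "codiff br \<omega> =
     (\<lambda>xs. - (\<Sum>e\<in>Basis. interior_product e (nabla_form br e \<omega>) xs))"

lemma linear_nabla_left:
  assumes "bilinear br"
  shows "linear (\<lambda>x. nabla br x y)"
proof (rule linearI)
  note k = nabla_koszul[OF assms]
  note s = inner_add_right inner_add_left bilinear_radd[OF assms] bilinear_ladd[OF assms]
    bilinear_rmul[OF assms] bilinear_lmul[OF assms]
  fix a b :: 'a and c :: real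
  have "2 * (nabla br (a + b) y \<bullet> z) = 2 * ((nabla br a y + nabla br b y) \<bullet> z)" for z
    unfolding inner_add_left distrib_left k by (simp add: s)
  then show "nabla br (a + b) y = nabla br a y + nabla br b y"
    by (intro iffD1[OF vector_eq_rdot]) simp
  have "2 * (nabla br (c *\<^sub>R a) y \<bullet> z) = c * (2 * (nabla br a y \<bullet> z))" for z
    unfolding k by (simp add: s algebra_simps)
  then show "nabla br (c *\<^sub>R a) y = c *\<^sub>R nabla br a y"
    by (intro iffD1[OF vector_eq_rdot]) simp
qed

lemma linear_nabla_right:
  assumes "bilinear br"
  shows "linear (nabla br x)"
proof (rule linearI)
  note k = nabla_koszul[OF assms]
  note s = inner_add_right inner_add_left bilinear_radd[OF assms] bilinear_ladd[OF assms]
    bilinear_rmul[OF assms] bilinear_lmul[OF assms]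
  fix a b :: 'a and c :: real
  have "2 * (nabla br x (a + b) \<bullet> z) = 2 * ((nabla br x a + nabla br x b) \<bullet> z)" for z
    unfolding inner_add_left distrib_left k by (simp add: s)
  then show "nabla br x (a + b) = nabla br x a + nabla br x b"
    by (intro iffD1[OF vector_eq_rdot]) simp
  have "2 * (nabla br x (c *\<^sub>R a) \<bullet> z) = c * (2 * (nabla br x a \<bullet> z))" for z
    unfolding k by (simp add: s algebra_simps)
  then show "nabla br x (c *\<^sub>R a) = c *\<^sub>R nabla br x a"
    by (intro iffD1[OF vector_eq_rdot]) simp
qed

lemma trace_orthonormal:
  fixes f :: "'a::euclidean_space \<Rightarrow> 'a \<Rightarrow> real"
  assumes f: "bilinear f"
    and B: "pairwise orthogonal B" "\<forall>b\<in>B. norm b = 1" "span B = UNIV"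
  shows "(\<Sum>b\<in>B. f b b) = (\<Sum>e\<in>Basis. f e e)"
proof -
  have "finite B"
    using B pairwise_orthogonal_imp_finite by blast
  have rep: "(\<Sum>b\<in>B. (x \<bullet> b) *\<^sub>R b) = x" for x
  proof -
    have "(\<Sum>b\<in>B. (b \<bullet> x / (b \<bullet> b)) *\<^sub>R b) = (\<Sum>b\<in>B. (x \<bullet> b) *\<^sub>R b)"
      using B(2) by (intro sum.cong) (auto simp: dot_square_norm inner_commute)
    moreover have "orthogonal (x - (\<Sum>b\<in>B. (b \<bullet> x / (b \<bullet> b)) *\<^sub>R b)) y" for y
      using Gram_Schmidt_step[OF B(1), of y x] B(3) by (simp add: orthogonal_commute)
    ultimately show ?thesis
      by (metis orthogonal_self eq_iff_diff_eq_0)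
  qed
  have tr: "(\<Sum>b\<in>B. (e \<bullet> b) * (e' \<bullet> b)) = e \<bullet> e'" for e e'
  proof -
    have "e \<bullet> e' = (\<Sum>b\<in>B. (e \<bullet> b) *\<^sub>R b) \<bullet> e'"
      by (simp add: rep)
    then show ?thesis
      unfolding inner_sum_left by (simp add: inner_commute)
  qed
  have "f b b = (\<Sum>e\<in>Basis. \<Sum>e'\<in>Basis. (e \<bullet> b) * (e' \<bullet> b) * f e e')" for b
  proof -
    have "f b b = f (\<Sum>e\<in>Basis. (e \<bullet> b) *\<^sub>R e) (\<Sum>e\<in>Basis. (e \<bullet> b) *\<^sub>R e)"
      using euclidean_representation[of b] by (simp add: inner_commute)
    also have "\<dots> = (\<Sum>(e, e')\<in>Basis \<times> Basis. f ((e \<bullet> b) *\<^sub>R e) ((e' \<bullet> b) *\<^sub>R e'))"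
      by (rule bilinear_sum[OF f])
    also have "\<dots> = (\<Sum>e\<in>Basis. \<Sum>e'\<in>Basis. (e \<bullet> b) * (e' \<bullet> b) * f e e')"
      by (simp add: sum.cartesian_product bilinear_lmul[OF f] bilinear_rmul[OF f] mult_ac)
    finally show ?thesis .
  qed
  then have "(\<Sum>b\<in>B. f b b) =
      (\<Sum>b\<in>B. \<Sum>e\<in>Basis. \<Sum>e'\<in>Basis. (e \<bullet> b) * (e' \<bullet> b) * f e e')"
    by simp
  also have "\<dots> = (\<Sum>e\<in>Basis. \<Sum>b\<in>B. \<Sum>e'\<in>Basis. (e \<bullet> b) * (e' \<bullet> b) * f e e')"
    by (rule sum.swap)
  also have "\<dots> = (\<Sum>e\<in>Basis. \<Sum>e'\<in>Basis. \<Sum>b\<in>B. (e \<bullet> b) * (e' \<bullet> b) * f e e')"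
    by (intro sum.cong refl sum.swap)
  also have "\<dots> = (\<Sum>e\<in>Basis. \<Sum>e'\<in>Basis. (e \<bullet> e') * f e e')"
    by (simp add: sum_distrib_right[symmetric] tr)
  also have "\<dots> = (\<Sum>e\<in>Basis. \<Sum>e'\<in>Basis. if e = e' then f e e else 0)"
    by (intro sum.cong refl) (auto simp: inner_Basis)
  also have "\<dots> = (\<Sum>e\<in>Basis. f e e)"
    by simp
  finally show ?thesis .
qed

lemma codiff_orthonormal:
  fixes br :: "'a::euclidean_space \<Rightarrow> 'a \<Rightarrow> 'a"
  assumes br: "bilinear br" and form: "is_form p \<omega>" and len: "Suc (length xs) = p"
    and B: "pairwise orthogonal B" "\<forall>b\<in>B. norm b = 1" "span B = UNIV"
  shows "codiff br \<omega> xs = - (\<Sum>e\<in>B. interior_product e (nabla_form br e \<omega>) xs)"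
proof -
  let ?f = "\<lambda>x y. interior_product y (nabla_form br x \<omega>) xs"
  have lin: "linear (\<lambda>x. \<omega> (ys[i := x]))" if "length ys = p" "i < p" for ys i
    using form that by (auto simp: is_form_def)
  have "linear (\<lambda>x. ?f x y)" for y
  proof -
    have "linear (\<lambda>x. \<omega> ((y # xs)[i := nabla br x ((y # xs) ! i)]))" if "i < p" for i
      using linear_compose[OF linear_nabla_left[OF br] lin, of "y # xs" i] len that
      by (simp add: o_def)
    then show ?thesis
      using len unfolding interior_product_def nabla_form_def
      by (intro linear_compose_neg linear_compose_sum) auto
  qed
  moreover have "linear (\<lambda>y. ?f x y)" for x
  proof -
    have "linear (\<lambda>y. \<omega> ((y # xs)[i := nabla br x ((y # xs) ! i)]))" if "i < p" for i
    proof (cases i)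
      case 0
      then show ?thesis
        using linear_compose[OF linear_nabla_right[OF br] lin, of "x # xs" 0] len
        by (simp add: o_def)
    next
      case (Suc j)
      then show ?thesis
        using lin[of "x # xs[j := nabla br x (xs ! j)]" 0] len by simp
    qed
    then show ?thesis
      using len unfolding interior_product_def nabla_form_def
      by (intro linear_compose_neg) (simp add: linear_compose_sum)
  qed
  ultimately have "bilinear ?f"
    by (simp add: bilinear_def)
  from trace_orthonormal[OF this B] show ?thesis
    by (simp add: codiff_def)
qed


section \<open>Conformal Killing forms\<close>

definition cky :: "('a::euclidean_space \<Rightarrow> 'a \<Rightarrow> 'a) \<Rightarrow> nat \<Rightarrow> 'a form \<Rightarrow> bool" where
  "cky br p \<omega> \<longleftrightarrow> is_form p \<omega> \<and>
     (\<forall>x xs. length xs = p \<longrightarrow>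
        nabla_form br x \<omega> xs =
          1 / (real p + 1) * interior_product x (ext_deriv br \<omega>) xs
          - 1 / (real DIM('a) - real p + 1) * wedge_dual x (codiff br \<omega>) xs)"

definition ky :: "('a::euclidean_space \<Rightarrow> 'a \<Rightarrow> 'a) \<Rightarrow> nat \<Rightarrow> 'a form \<Rightarrow> bool" where
  "ky br p \<omega> \<longleftrightarrow> is_form p \<omega> \<and>
     (\<forall>x xs. length xs = p \<longrightarrow>
        nabla_form br x \<omega> xs = 1 / (real p + 1) * interior_product x (ext_deriv br \<omega>) xs)"

definition star_killing :: "('a::euclidean_space \<Rightarrow> 'a \<Rightarrow> 'a) \<Rightarrow> nat \<Rightarrow> 'a form \<Rightarrow> bool" where
  "star_killing br p \<omega> \<longleftrightarrow>
     cky br p \<omega> \<and> (\<forall>xs. length xs = Suc p \<longrightarrow> ext_deriv br \<omega> xs = 0)"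

definition parallel_form :: "('a::euclidean_space \<Rightarrow> 'a \<Rightarrow> 'a) \<Rightarrow> nat \<Rightarrow> 'a form \<Rightarrow> bool" where
  "parallel_form br p \<omega> \<longleftrightarrow> is_form p \<omega> \<and>
     (\<forall>x xs. length xs = p \<longrightarrow> nabla_form br x \<omega> xs = 0)"

definition strict_cky :: "('a::euclidean_space \<Rightarrow> 'a \<Rightarrow> 'a) \<Rightarrow> nat \<Rightarrow> 'a form \<Rightarrow> bool" where
  "strict_cky br p \<omega> \<longleftrightarrow> cky br p \<omega> \<and> \<not> ky br p \<omega>"

definition killing_vector :: "('a::euclidean_space \<Rightarrow> 'a \<Rightarrow> 'a) \<Rightarrow> 'a \<Rightarrow> bool" where
  "killing_vector br z \<longleftrightarrow> ky br 1 (dual_form z)"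

definition strict_killing_vector :: "('a::euclidean_space \<Rightarrow> 'a \<Rightarrow> 'a) \<Rightarrow> 'a \<Rightarrow> bool" where
  "strict_killing_vector br z \<longleftrightarrow>
     killing_vector br z \<and> \<not> parallel_form br 1 (dual_form z)"

end

theory Submission
  imports Defs "Jordan_Normal_Form.Determinant"
begin

text \<open>
  The Koszul formula makes the Killing condition on a left-invariant field purely algebraic:
  \<open>z\<close> is a Killing vector iff \<open>ad\<^sub>z\<close> is skew-symmetric, and it is strict iff in addition it is
  not orthogonal to the derived algebra (\<open>strict_killing_vector_iff\<close>). In the almost abelian
  case this determines all strict Killing vectors: they are exactly the elements of
  \<open>Ker (A + S)\<close> outside \<open>Ker A \<inter> Ker S\<close> (\<open>almost_abelian_strict_killing_iff\<close>). So a strict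
  Killing vector exists iff the inclusion of the kernels is strict, and it can be any element
  of the difference.

  What remains is to find a strict \<open>*\<close>-Killing \<open>(d - 1)\<close>-form from a strict Killing vector
  \<open>z\<close>, and on any metric Lie algebra the Hodge dual \<open>\<omega> = z \<lrcorner> vol\<close> is one. As \<open>vol\<close> is
  parallel, \<open>\<nabla>\<^sub>x \<omega> = (\<nabla>\<^sub>x z) \<lrcorner> vol\<close>. Since \<open>x \<mapsto> \<nabla>\<^sub>x z\<close> is skew-symmetric, its trace is zero,
  which is \<open>d\<omega> = 0\<close> (\<open>ext_deriv_hodge_killing\<close>), and \<open>x\<^sup>* \<and> d\<^sup>*\<omega> = - 2 \<nabla>\<^sub>x \<omega>\<close>
  (\<open>wedge_codiff_hodge_killing\<close>), which is the conformal Killing equation in degree \<open>d - 1\<close>.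
  Finally \<open>\<omega>\<close> is not Killing, because a closed Killing form is parallel and \<open>\<nabla>z \<noteq> 0\<close>.

  The volume form is a determinant of coordinates. Beyond multilinearity, alternation and the
  value 1 on the standard basis, all that matters about it is Cramer's rule in the form
  \<open>x\<^sup>* \<and> vol = 0\<close> (\<open>vol_cramer\<close>); it yields that \<open>vol\<close> is parallel, that it is non-degenerate, and the formula
  for the codifferential.
\<close>

(* Both the inner product and the scalar product of coordinate vectors are written as a bullet;
   here it stands for the inner product. *)
no_notation scalar_prod (infix "\<bullet>" 70)

section \<open>Alternating forms on lists\<close>

lemma nths_Compl_Cons:
  "nths (x # xs) (- {0}) = xs"
  "nths (x # xs) (- {Suc i}) = x # nths xs (- {i})"
  "nths (x # xs) (- {0, Suc j}) = nths xs (- {j})"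
  "nths (x # xs) (- {Suc i, Suc j}) = x # nths xs (- {i, j})"
proof -
  have "{j. Suc j \<in> - {Suc i}} = - {i}" "{j. Suc j \<in> - {0}} = UNIV"
    "{k. Suc k \<in> - {0, Suc j}} = - {j}" "{k. Suc k \<in> - {Suc i, Suc j}} = - {i, j}"
    by auto
  then show "nths (x # xs) (- {0}) = xs"
    "nths (x # xs) (- {Suc i}) = x # nths xs (- {i})"
    "nths (x # xs) (- {0, Suc j}) = nths xs (- {j})"
    "nths (x # xs) (- {Suc i, Suc j}) = x # nths xs (- {i, j})"
    by (simp_all add: nths_Cons nths_all)
qed

lemma nths_Compl_singleton:
  "i < length xs \<Longrightarrow> nths xs (- {i}) = take i xs @ drop (Suc i) xs"
proof (induction xs arbitrary: i)
  case (Cons x xs)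
  then show ?case
    by (cases i) (simp_all add: nths_Compl_Cons)
qed simp

lemma length_nths_Compl_singleton:
  "i < length xs \<Longrightarrow> length (nths xs (- {i})) = length xs - 1"
  by (simp add: nths_Compl_singleton)

lemma nth_nths_Compl_singleton:
  assumes "i < length xs" "k < length xs - 1"
  shows "nths xs (- {i}) ! k = xs ! (if k < i then k else Suc k)"
  using assms by (simp add: nths_Compl_singleton nth_append min_def)

text \<open>Removing two entries one after the other: once the left entry \<open>i\<close> is gone, the entry at
  position \<open>j\<close> has moved to position \<open>j - 1\<close>. This shift is the source of the signs in
  \<open>ext_deriv_eq_sum_nabla_form\<close> below.\<close>

lemma nths_remove_twice:
  assumes "i < j" "j < length xs"
  shows "nths (nths xs (- {j})) (- {i}) = nths xs (- {i, j})"
    and "nths (nths xs (- {i})) (- {j - 1}) = nths xs (- {i, j})"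
proof -
  have "nths (nths xs (- {j})) (- {i}) = nths xs (- {i, j}) \<and>
      nths (nths xs (- {i})) (- {j - 1}) = nths xs (- {i, j})"
    using assms
  proof (induction xs arbitrary: i j)
    case (Cons x xs)
    from Cons.prems obtain j' where j: "j = Suc j'"
      by (cases j) auto
    show ?case
    proof (cases i)
      case 0
      then show ?thesis
        by (simp add: j nths_Compl_Cons)
    next
      case (Suc i')
      with Cons.prems j obtain j'' where j': "j' = Suc j''"
        by (cases j') auto
      have "nths (nths xs (- {j'})) (- {i'}) = nths xs (- {i', j'})"
        "nths (nths xs (- {i'})) (- {j' - 1}) = nths xs (- {i', j'})"
        using Cons.IH[of i' j'] Cons.prems j Suc by auto
      then show ?thesis
        by (simp add: j j' Suc nths_Compl_Cons)
    qed
  qed simp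
  then show "nths (nths xs (- {j})) (- {i}) = nths xs (- {i, j})"
    "nths (nths xs (- {i})) (- {j - 1}) = nths xs (- {i, j})"
    by blast+
qed

lemma is_form_linear:
  "is_form p \<omega> \<Longrightarrow> length xs = p \<Longrightarrow> i < p \<Longrightarrow> linear (\<lambda>x. \<omega> (xs[i := x]))"
  by (simp add: is_form_def)

lemma is_form_linear_Cons:
  assumes "is_form (Suc p) \<omega>" "length xs = p"
  shows "linear (\<lambda>x. \<omega> (x # xs))"
  using is_form_linear[OF assms(1), of "undefined # xs" 0] assms(2) by simp

text \<open>Polarisation: expand the value on a list with \<open>x + y\<close> in both positions. Adjacent
  positions suffice, because longer moves are composed of adjacent transpositions.\<close>

lemma is_form_swap:
  assumes \<omega>: "is_form p \<omega>" and len: "length (as @ x # y # bs) = p"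
  shows "\<omega> (as @ x # y # bs) = - \<omega> (as @ y # x # bs)"
proof -
  let ?f = "\<lambda>u v. \<omega> (as @ u # v # bs)"
  have l1: "linear (\<lambda>u. ?f u v)" and l2: "linear (\<lambda>v. ?f u v)" for u v
    using is_form_linear[OF \<omega>, of "as @ u # v # bs" "length as"]
      is_form_linear[OF \<omega>, of "as @ u # v # bs" "Suc (length as)"] len
    by (simp_all add: list_update_append)
  have alt: "?f u u = 0" for u
  proof -
    have "\<forall>xs i j. length xs = p \<and> i < j \<and> j < p \<and> xs ! i = xs ! j \<longrightarrow> \<omega> xs = 0"
      using \<omega> by (simp add: is_form_def)
    from this[rule_format, of "as @ u # u # bs" "length as" "Suc (length as)"] len
    show ?thesis
      by (simp add: nth_append)
  qed
  have "0 = ?f (x + y) (x + y)"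
    by (simp only: alt)
  also have "\<dots> = ?f x x + ?f x y + (?f y x + ?f y y)"
    by (simp only: linear_add[OF l1] linear_add[OF l2])
  finally show ?thesis
    by (simp add: alt)
qed

lemma is_form_move_front:
  assumes "is_form p \<omega>" "length (x # as @ bs) = p"
  shows "\<omega> (x # as @ bs) = (- 1) ^ length as * \<omega> (as @ x # bs)"
  using assms(2)
proof (induction as arbitrary: bs rule: rev_induct)
  case (snoc a as)
  then show ?case
    using is_form_swap[OF assms(1), of as x a bs] by simp
qed simp

text \<open>The two ways of saying that the argument number \<open>i\<close> is contracted with \<open>x\<close>: the
  definitions of \<open>d\<close>, of \<open>d\<^sup>*\<close> and of the wedge product put \<open>x\<close> in front and delete an
  entry, whereas the covariant derivative of a form replaces an entry in place.\<close>

lemma is_form_Cons_nths: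
  assumes "is_form p \<omega>" "length xs = p" "i < p"
  shows "\<omega> (x # nths xs (- {i})) = (- 1) ^ i * \<omega> (xs[i := x])"
  using is_form_move_front[OF assms(1), of x "take i xs" "drop (Suc i) xs"] assms(2,3)
  by (simp add: nths_Compl_singleton upd_conv_take_nth_drop min_def)

lemma is_form_interior_product:
  assumes \<omega>: "is_form (Suc p) \<omega>"
  shows "is_form p (interior_product x \<omega>)"
  unfolding is_form_def interior_product_def
proof (intro conjI allI impI)
  fix xs :: "'a list" and i
  assume "length xs = p \<and> i < p"
  then show "linear (\<lambda>y. \<omega> (x # xs[i := y]))"
    using is_form_linear[OF \<omega>, of "x # xs" "Suc i"] by simp
next
  fix xs :: "'a list" and i j
  assume *: "length xs = p \<and> i < j \<and> j < p \<and> xs ! i = xs ! j"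
  have "\<forall>xs i j. length xs = Suc p \<and> i < j \<and> j < Suc p \<and> xs ! i = xs ! j \<longrightarrow> \<omega> xs = 0"
    using \<omega> by (simp add: is_form_def)
  from this[rule_format, of "x # xs" "Suc i" "Suc j"] * show "\<omega> (x # xs) = 0"
    by simp
qed

section \<open>The volume form\<close>

definition std_basis :: "'a::euclidean_space list" where
  "std_basis = (SOME bs. set bs = Basis \<and> distinct bs)"

lemma std_basis:
  "set (std_basis :: 'a::euclidean_space list) = Basis"
  "distinct (std_basis :: 'a list)"
  "length (std_basis :: 'a list) = DIM('a)"
proof -
  have "\<exists>bs. set bs = (Basis :: 'a set) \<and> distinct bs"
    using finite_distinct_list[OF finite_Basis] by auto
  from someI_ex[OF this] show
    1: "set (std_basis :: 'a list) = Basis" and 2: "distinct (std_basis :: 'a list)"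
    by (simp_all add: std_basis_def)
  show "length (std_basis :: 'a list) = DIM('a)"
    using distinct_card[OF 2] 1 by simp
qed

definition coord_mat :: "'a::euclidean_space list \<Rightarrow> real mat" where
  "coord_mat xs = mat DIM('a) DIM('a) (\<lambda>(i, j). xs ! i \<bullet> std_basis ! j)"

definition vol :: "'a::euclidean_space form" where
  "vol xs = Determinant.det (coord_mat xs)"

lemma coord_mat_carrier:
  "coord_mat (xs :: 'a::euclidean_space list) \<in> carrier_mat DIM('a) DIM('a)"
  by (simp add: coord_mat_def)

lemma sum_std_basis:
  "(\<Sum>j<DIM('a). f (std_basis ! j)) = (\<Sum>e\<in>(Basis :: 'a::euclidean_space set). f e)"
proof -
  have "bij_betw ((!) std_basis) {..<DIM('a)} (Basis :: 'a set)"
    using bij_betw_nth[OF std_basis(2)] std_basis by metis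
  from sum.reindex_bij_betw[OF this] show ?thesis .
qed

lemma inner_std_basis: 
  "x \<bullet> y = (\<Sum>j<DIM('a). (x \<bullet> std_basis ! j) * (y \<bullet> std_basis ! j))" for x y :: "'a::euclidean_space"
  by (simp add: sum_std_basis[of "\<lambda>e. (x \<bullet> e) * (y \<bullet> e)"] euclidean_inner[of x y])

text \<open>Laplace expansion along row \<open>i\<close>; the cofactors of that row do not see its entries.
  So the value is visibly linear in \<open>y\<close>, with coefficients that are the entries of the
  adjugate matrix.\<close>

lemma vol_update:
  fixes xs :: "'a::euclidean_space list"
  assumes "length xs = DIM('a)" "i < DIM('a)"
  shows "vol (xs[i := y]) = (\<Sum>j<DIM('a). (y \<bullet> std_basis ! j) * cofactor (coord_mat xs) i j)"
proof -
  have del: "mat_delete (coord_mat (xs[i := y])) i j = mat_delete (coord_mat xs) i j"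
    if "j < DIM('a)" for j
    unfolding mat_delete_def
    by (rule eq_matI) (use assms that in \<open>auto simp: coord_mat_def nth_list_update\<close>)
  have "vol (xs[i := y]) =
      (\<Sum>j<DIM('a). coord_mat (xs[i := y]) $$ (i, j) * cofactor (coord_mat (xs[i := y])) i j)"
    unfolding vol_def by (rule laplace_expansion_row[OF coord_mat_carrier assms(2)])
  also have "\<dots> = (\<Sum>j<DIM('a). (y \<bullet> std_basis ! j) * cofactor (coord_mat xs) i j)"
    using assms del by (intro sum.cong) (auto simp: cofactor_def coord_mat_def)
  finally show ?thesis .
qed

lemma is_form_vol: "is_form DIM('a) (vol :: 'a::euclidean_space form)"
  unfolding is_form_def
proof (intro conjI allI impI)
  fix xs :: "'a list" and i
  assume "length xs = DIM('a) \<and> i < DIM('a)"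
  then show "linear (\<lambda>x. vol (xs[i := x]))"
    by (intro linearI)
      (simp_all add: vol_update inner_add_left algebra_simps sum.distrib sum_distrib_left)
next
  fix xs :: "'a list" and i j
  assume *: "length xs = DIM('a) \<and> i < j \<and> j < DIM('a) \<and> xs ! i = xs ! j"
  then have "row (coord_mat xs) i = row (coord_mat xs) j"
    by (intro eq_vecI) (auto simp: coord_mat_def)
  with * show "vol xs = 0"
    unfolding vol_def by (intro det_identical_rows[OF coord_mat_carrier, of i j]) auto
qed

lemma vol_std_basis: "vol (std_basis :: 'a::euclidean_space list) = 1"
proof -
  have "coord_mat (std_basis :: 'a list) = 1\<^sub>m DIM('a)"
  proof (rule eq_matI)
    fix i j
    assume "i < dim_row (1\<^sub>m DIM('a))" "j < dim_col (1\<^sub>m DIM('a))"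
    then have "i < DIM('a)" "j < DIM('a)" by auto
    moreover from this have "(std_basis ! i :: 'a) \<in> Basis" "(std_basis ! j :: 'a) \<in> Basis"
      using std_basis nth_mem by metis+
    ultimately show "coord_mat (std_basis :: 'a list) $$ (i, j) = 1\<^sub>m DIM('a) $$ (i, j)"
      using std_basis(2,3)[where 'a='a]
      by (auto simp: coord_mat_def inner_Basis nth_eq_iff_index_eq)
  qed (simp_all add: coord_mat_def)
  then show ?thesis
    by (simp add: vol_def)
qed

text \<open>Cramer's rule \<open>\<Sum>\<^sub>i vol(x\<^sub>1, \<dots>, y, \<dots>, x\<^sub>d) x\<^sub>i = vol(x\<^sub>1, \<dots>, x\<^sub>d) y\<close>, paired with a
  vector \<open>x\<close>. It says that the \<open>(d + 1)\<close>-form \<open>x\<^sup>* \<and> vol\<close> vanishes, and it holds for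
  linearly dependent \<open>x\<^sub>i\<close> as well, being the product of the adjugate matrix with the matrix
  itself. All computations with the volume form below rest on this identity.\<close>

lemma vol_cramer:
  fixes xs :: "'a::euclidean_space list"
  assumes len: "length xs = DIM('a)"
  shows "(\<Sum>i<DIM('a). vol (xs[i := y]) * (xs ! i \<bullet> x)) = (y \<bullet> x) * vol xs"
proof -
  let ?d = "DIM('a)" and ?b = "\<lambda>j. std_basis ! j :: 'a" and ?C = "cofactor (coord_mat xs)"
  have adj: "(\<Sum>i<?d. ?C i j * (xs ! i \<bullet> ?b k)) = (if j = k then vol xs else 0)"
    if "j < ?d" "k < ?d" for j k
  proof -
    have "(adj_mat (coord_mat xs) * coord_mat xs) $$ (j, k)
        = (Determinant.det (coord_mat xs) \<cdot>\<^sub>m 1\<^sub>m ?d) $$ (j, k)"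
      by (simp only: adj_mat(3)[OF coord_mat_carrier])
    then show ?thesis
      using that by (simp add: adj_mat_def coord_mat_def scalar_prod_def vol_def
          atLeast0LessThan split: if_splits)
  qed
  have "(\<Sum>i<?d. vol (xs[i := y]) * (xs ! i \<bullet> x)) =
      (\<Sum>i<?d. \<Sum>j<?d. \<Sum>k<?d. (y \<bullet> ?b j) * (x \<bullet> ?b k) * (?C i j * (xs ! i \<bullet> ?b k)))"
    using len
    by (intro sum.cong refl)
      (simp add: vol_update inner_std_basis[of "xs ! _" x] sum_product mult_ac)
  also have "\<dots> = (\<Sum>j<?d. \<Sum>i<?d. \<Sum>k<?d. (y \<bullet> ?b j) * (x \<bullet> ?b k) * (?C i j * (xs ! i \<bullet> ?b k)))"
    by (rule sum.swap)
  also have "\<dots> = (\<Sum>j<?d. \<Sum>k<?d. (y \<bullet> ?b j) * (x \<bullet> ?b k) * (\<Sum>i<?d. ?C i j * (xs ! i \<bullet> ?b k)))"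
    unfolding sum_distrib_left by (intro sum.cong refl sum.swap)
  also have "\<dots> = (\<Sum>j<?d. \<Sum>k<?d. if j = k then (y \<bullet> ?b j) * (x \<bullet> ?b k) * vol xs else 0)"
    by (intro sum.cong refl) (auto simp: adj)
  also have "\<dots> = (y \<bullet> x) * vol xs"
    by (simp add: inner_std_basis[of y x] sum_distrib_right)
  finally show ?thesis .
qed

lemma linear_expand_Basis:
  fixes g :: "'a::euclidean_space \<Rightarrow> real"
  assumes "linear g"
  shows "g w = (\<Sum>e\<in>Basis. (w \<bullet> e) * g e)"
proof -
  have "g w = g (\<Sum>e\<in>Basis. (w \<bullet> e) *\<^sub>R e)"
    by (simp add: euclidean_representation)
  then show ?thesis
    by (simp add: linear_sum[OF assms] linear_cmul[OF assms])
qed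

text \<open>A skew-symmetric endomorphism, acting on the volume form as a derivation, multiplies it by
  its trace, which is zero. To see this from Cramer's rule, expand \<open>f x\<^sub>i\<close> in the standard
  basis and move \<open>f\<close> to the basis vectors: what remains are the diagonal entries
  \<open>e \<bullet> f e = 0\<close>. As \<open>\<nabla>\<^sub>x\<close> is skew-symmetric, this lemma gives \<open>\<nabla>vol = 0\<close>.\<close>

lemma sum_vol_update_skew:
  fixes xs :: "'a::euclidean_space list"
  assumes skew: "\<And>x y. f x \<bullet> y = - (x \<bullet> f y)" and len: "length xs = DIM('a)"
  shows "(\<Sum>i<DIM('a). vol (xs[i := f (xs ! i)])) = 0"
proof -
  have "(\<Sum>i<DIM('a). vol (xs[i := f (xs ! i)])) =
      (\<Sum>i<DIM('a). \<Sum>e\<in>Basis. (f (xs ! i) \<bullet> e) * vol (xs[i := e]))"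
    using is_form_linear[OF is_form_vol len]
    by (intro sum.cong refl linear_expand_Basis) auto
  also have "\<dots> = (\<Sum>e\<in>Basis. \<Sum>i<DIM('a). (f (xs ! i) \<bullet> e) * vol (xs[i := e]))"
    by (rule sum.swap)
  also have "\<dots> = (\<Sum>e\<in>Basis. - (\<Sum>i<DIM('a). vol (xs[i := e]) * (xs ! i \<bullet> f e)))"
    by (simp add: skew sum_negf mult.commute)
  also have "\<dots> = (\<Sum>e\<in>Basis. - ((e \<bullet> f e) * vol xs))"
    by (simp add: vol_cramer[OF len])
  also have "\<dots> = 0"
  proof -
    have "e \<bullet> f e = 0" for e
      using skew[of e e] by (simp add: inner_commute)
    then show ?thesis
      by simp
  qed
  finally show ?thesis .
qed

text \<open>If \<open>w\<close> has a non-zero component along a basis vector \<open>e\<close>, then substituting \<open>w\<close> for \<open>e\<close>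
  in the standard basis gives a basis; the remaining basis vectors serve as \<open>xs\<close>.\<close>

lemma vol_nondegenerate:
  fixes w :: "'a::euclidean_space"
  assumes "w \<noteq> 0"
  obtains xs where "length xs = DIM('a) - 1" "vol (w # xs) \<noteq> 0"
proof -
  obtain e where e: "e \<in> Basis" "w \<bullet> e \<noteq> 0"
    using assms by (metis euclidean_all_zero_iff)
  have "(\<Sum>i<DIM('a). vol (std_basis[i := w]) * (std_basis ! i \<bullet> e)) = w \<bullet> e"
    using vol_cramer[of std_basis w e] by (simp add: std_basis vol_std_basis)
  with e(2) obtain k where k: "k < DIM('a)" "vol (std_basis[k := w]) \<noteq> 0"
    by (metis (no_types, lifting) lessThan_iff mult_zero_left sum.neutral)
  have "vol (w # nths std_basis (- {k})) \<noteq> 0"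
    using is_form_Cons_nths[OF is_form_vol std_basis(3) k(1), of w] k(2) by simp
  moreover have "length (nths (std_basis :: 'a list) (- {k})) = DIM('a) - 1"
    using k(1) by (simp add: length_nths_Compl_singleton std_basis)
  ultimately show thesis
    using that by blast
qed

section \<open>The Levi-Civita connection and the exterior derivative\<close>

lemma lie_bracket_bilinear: "lie_bracket br \<Longrightarrow> bilinear br"
  by (simp add: lie_bracket_def)

lemma lie_bracket_swap:
  assumes "lie_bracket br"
  shows "br y x = - br x y"
proof -
  have b: "bilinear br" and alt: "\<And>x. br x x = 0"
    using assms by (simp_all add: lie_bracket_def)
  have "0 = br (x + y) (x + y)"
    by (simp add: alt)
  also have "\<dots> = br x y + br y x"
    unfolding bilinear_ladd[OF b] bilinear_radd[OF b] by (simp add: alt)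
  finally show ?thesis
    by (metis add.commute add_eq_0_iff)
qed

lemma nabla_torsion_free:
  assumes "lie_bracket br"
  shows "nabla br x y - nabla br y x = br x y"
proof -
  note k = nabla_koszul[OF lie_bracket_bilinear[OF assms]]
  have "2 * ((nabla br x y - nabla br y x) \<bullet> z) = 2 * (br x y \<bullet> z)" for z
    using lie_bracket_swap[OF assms, of x y] lie_bracket_swap[OF assms, of x z]
      lie_bracket_swap[OF assms, of y z]
    unfolding inner_diff_left right_diff_distrib k by simp
  then show ?thesis
    by (intro iffD1[OF vector_eq_rdot]) simp
qed

lemma nabla_skew:
  assumes "lie_bracket br"
  shows "nabla br x y \<bullet> z = - (y \<bullet> nabla br x z)"
proof -
  note k = nabla_koszul[OF lie_bracket_bilinear[OF assms]]
  show ?thesis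
    using k[of x y z] k[of x z y] lie_bracket_swap[OF assms, of x y]
      lie_bracket_swap[OF assms, of x z] lie_bracket_swap[OF assms, of y z]
    by (simp add: inner_commute)
qed

text \<open>The formula \<open>d\<omega> = \<Sum>\<^sub>i e\<^sub>i\<^sup>* \<and> \<nabla>\<^bsub>e\<^sub>i\<^esub> \<omega>\<close>, evaluated on a list. The connection is torsion
  free, so every bracket \<open>[x\<^sub>i, x\<^sub>j]\<close> in \<open>d\<omega>\<close> is \<open>\<nabla>\<^bsub>x\<^sub>i\<^esub> x\<^sub>j - \<nabla>\<^bsub>x\<^sub>j\<^esub> x\<^sub>i\<close>. The resulting terms,
  indexed by ordered pairs of distinct positions, are those of the sum of the
  \<open>\<nabla>\<^bsub>x\<^sub>i\<^esub> \<omega>\<close>. The proof starts from the latter, splits it into the pairs with \<open>k < i\<close> and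
  those with \<open>k > i\<close>, and recombines them.\<close>

lemma ext_deriv_eq_sum_nabla_form:
  assumes br: "lie_bracket br" and \<omega>: "is_form p \<omega>" and len: "length xs = Suc p"
  shows "ext_deriv br \<omega> xs =
    (\<Sum>i<Suc p. (- 1) ^ i * nabla_form br (xs ! i) \<omega> (nths xs (- {i})))"
proof -
  let ?N = "\<lambda>i k. nabla br (xs ! i) (xs ! k)"
  let ?t = "\<lambda>i k. \<omega> (?N i k # nths xs (- {i, k}))"
  have lin: "linear (\<lambda>x. \<omega> (x # nths xs (- {i, j})))" if "i < j" "j < Suc p" for i j
  proof -
    have "length (nths (nths xs (- {j})) (- {i})) = p - 1"
      using that len by (simp add: length_nths_Compl_singleton)
    then have "length (nths xs (- {i, j})) = p - 1"
      using nths_remove_twice(1)[of i j xs] that len by simp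
    then show ?thesis
      using is_form_linear_Cons[of "p - 1" \<omega>] \<omega> that by simp
  qed
  have *: "nabla_form br (xs ! i) \<omega> (nths xs (- {i})) =
      - (\<Sum>k<i. (- 1) ^ k * ?t i k) + (\<Sum>k\<in>{i<..<Suc p}. (- 1) ^ k * ?t i k)"
    if i: "i < Suc p" for i
  proof -
    let ?ys = "nths xs (- {i})"
    let ?g = "\<lambda>k. \<omega> (?ys[k := nabla br (xs ! i) (?ys ! k)])"
    have leny: "length ?ys = p"
      using i len by (simp add: length_nths_Compl_singleton)
    have front: "?g k = (- 1) ^ k * \<omega> (nabla br (xs ! i) (?ys ! k) # nths ?ys (- {k}))"
      if "k < p" for k
      using is_form_Cons_nths[OF \<omega> leny that] by simp
    have "(\<Sum>k<p. ?g k) = (\<Sum>k<i. ?g k) + (\<Sum>k\<in>{i..<p}. ?g k)"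
      using i sum.atLeastLessThan_concat[of 0 i p ?g] by (simp add: atLeast0LessThan)
    also have "(\<Sum>k<i. ?g k) = (\<Sum>k<i. (- 1) ^ k * ?t i k)"
    proof (intro sum.cong refl)
      fix k assume "k \<in> {..<i}"
      then show "?g k = (- 1) ^ k * ?t i k"
        using i len front[of k] nths_remove_twice(1)[of k i xs]
        by (simp add: nth_nths_Compl_singleton insert_commute)
    qed
    \<comment> \<open>The entry \<open>k > i\<close> of \<open>xs\<close> is the entry \<open>k - 1\<close> of \<open>?ys\<close>, hence the change of sign.\<close>
    also have "(\<Sum>k\<in>{i..<p}. ?g k) = (\<Sum>k\<in>{Suc i..<Suc p}. ?g (k - 1))"
      by (subst sum.shift_bounds_Suc_ivl) simp
    also have "\<dots> = (\<Sum>k\<in>{Suc i..<Suc p}. - ((- 1) ^ k * ?t i k))"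
    proof (intro sum.cong refl)
      fix k assume k: "k \<in> {Suc i..<Suc p}"
      then obtain l where l: "k = Suc l"
        by (cases k) auto
      show "?g (k - 1) = - ((- 1) ^ k * ?t i k)"
        using i len k l front[of l] nths_remove_twice(2)[of i k xs]
        by (simp add: nth_nths_Compl_singleton)
    qed
    also have "{Suc i..<Suc p} = {i<..<Suc p}"
      by auto
    finally show ?thesis
      unfolding nabla_form_def leny by (simp add: sum_negf)
  qed
  have "(\<Sum>i<Suc p. (- 1) ^ i * nabla_form br (xs ! i) \<omega> (nths xs (- {i}))) =
      - (\<Sum>i<Suc p. \<Sum>k<i. (- 1) ^ (i + k) * ?t i k)
      + (\<Sum>i<Suc p. \<Sum>k\<in>{i<..<Suc p}. (- 1) ^ (i + k) * ?t i k)"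
    by (simp add: * sum_subtractf sum_distrib_left power_add right_diff_distrib mult.assoc
      del: sum.lessThan_Suc)
  also have "(\<Sum>i<Suc p. \<Sum>k\<in>{i<..<Suc p}. (- 1) ^ (i + k) * ?t i k) =
      (\<Sum>k<Suc p. \<Sum>i<k. (- 1) ^ (i + k) * ?t i k)"
    unfolding sum.Sigma[OF finite_lessThan ballI[OF finite_greaterThanLessThan]]
      sum.Sigma[OF finite_lessThan ballI[OF finite_lessThan]]
    by (rule sum.reindex_bij_witness[of _ "\<lambda>(k, i). (i, k)" "\<lambda>(i, k). (k, i)"]) auto
  also have "- (\<Sum>i<Suc p. \<Sum>k<i. (- 1) ^ (i + k) * ?t i k) +
      (\<Sum>k<Suc p. \<Sum>i<k. (- 1) ^ (i + k) * ?t i k) =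
      (\<Sum>j<Suc p. \<Sum>i<j. (- 1) ^ (i + j) * (?t i j - ?t j i))"
    by (simp add: sum_subtractf right_diff_distrib add.commute del: sum.lessThan_Suc)
  also have "\<dots> = ext_deriv br \<omega> xs"
    unfolding ext_deriv_def len
  proof (intro sum.cong refl)
    fix j i assume "j \<in> {..<Suc p}" "i \<in> {..<j}"
    then have "?t i j - ?t j i = \<omega> (br (xs ! i) (xs ! j) # nths xs (- {i, j}))"
      using linear_diff[OF lin[of i j], of "?N i j" "?N j i"]
      by (simp add: nabla_torsion_free[OF br] insert_commute)
    then show "(- 1) ^ (i + j) * (?t i j - ?t j i) =
        (- 1) ^ (i + j) * \<omega> (br (xs ! i) (xs ! j) # nths xs (- {i, j}))"
      by simp
  qed
  finally show ?thesis ..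
qed

section \<open>Killing vectors and their Hodge duals\<close>

lemma all_lists_length_one: "(\<forall>xs. length xs = 1 \<longrightarrow> P xs) \<longleftrightarrow> (\<forall>y. P [y])"
  by (auto simp: length_Suc_conv)

text \<open>For left-invariant fields the Killing equation is algebraic: the Koszul formula turns
  \<open>2 \<langle>z, \<nabla>\<^sub>x y\<rangle> = \<langle>z, [x, y]\<rangle>\<close> into the vanishing of its two other terms, which is the
  skew-symmetry of \<open>ad\<^sub>z\<close>.\<close>

lemma killing_vector_iff_ad_skew:
  assumes br: "lie_bracket br"
  shows "killing_vector br z \<longleftrightarrow> (\<forall>x y. br z x \<bullet> y = - (x \<bullet> br z y))"
proof -
  have form: "is_form 1 (dual_form z)"
    by (auto simp: is_form_def dual_form_def length_Suc_conv inner_add_right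
        intro!: linearI)
  have nf: "nabla_form br x (dual_form z) [y] = - (z \<bullet> nabla br x y)" for x y
    by (simp add: nabla_form_def dual_form_def)
  have ed: "interior_product x (ext_deriv br (dual_form z)) [y] = - (z \<bullet> br x y)" for x y
    by (simp add: interior_product_def ext_deriv_def dual_form_def)
  have "killing_vector br z \<longleftrightarrow> (\<forall>x y. 2 * (z \<bullet> nabla br x y) = z \<bullet> br x y)"
    using form unfolding killing_vector_def ky_def all_lists_length_one nf ed
    by (simp add: field_simps)
  also have "\<dots> \<longleftrightarrow> (\<forall>x y. br z x \<bullet> y = - (x \<bullet> br z y))"
  proof -
    have "2 * (z \<bullet> nabla br x y) = z \<bullet> br x y \<longleftrightarrow> br z x \<bullet> y = - (x \<bullet> br z y)" for x y
      using nabla_koszul[OF lie_bracket_bilinear[OF br], of x y z] lie_bracket_swap[OF br, of z y]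
      by (auto simp: inner_commute)
    then show ?thesis
      by simp
  qed
  finally show ?thesis .
qed

lemma nabla_killing:
  assumes br: "lie_bracket br" and z: "killing_vector br z"
  shows "2 * (z \<bullet> nabla br x y) = z \<bullet> br x y"
  using nabla_koszul[OF lie_bracket_bilinear[OF br], of x y z] lie_bracket_swap[OF br, of z y]
    z[unfolded killing_vector_iff_ad_skew[OF br], rule_format, of x y]
  by (simp add: inner_commute)

lemma nabla_killing_skew:
  assumes br: "lie_bracket br" and z: "killing_vector br z"
  shows "nabla br x z \<bullet> y = - (x \<bullet> nabla br y z)"
  using nabla_killing[OF br z, of x y] nabla_killing[OF br z, of y x]
    nabla_skew[OF br, of x z y] nabla_skew[OF br, of y z x] lie_bracket_swap[OF br, of x y]
  by (simp add: inner_commute)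

text \<open>The covariant derivative of a Killing vector \<open>z\<close> is half of \<open>dz\<^sup>*\<close>, so \<open>z\<close> is parallel
  exactly if it is orthogonal to the derived algebra.\<close>

lemma strict_killing_vector_iff:
  assumes br: "lie_bracket br"
  shows "strict_killing_vector br z \<longleftrightarrow>
    (\<forall>x y. br z x \<bullet> y = - (x \<bullet> br z y)) \<and> (\<exists>x y. z \<bullet> br x y \<noteq> 0)"
proof -
  have "parallel_form br 1 (dual_form z) \<longleftrightarrow> (\<forall>x y. z \<bullet> br x y = 0)" if z: "killing_vector br z"
  proof -
    have "is_form 1 (dual_form z)"
      using z by (simp add: killing_vector_def ky_def)
    then have "parallel_form br 1 (dual_form z) \<longleftrightarrow> (\<forall>x y. z \<bullet> nabla br x y = 0)"
      unfolding parallel_form_def all_lists_length_one by (simp add: nabla_form_def dual_form_def)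
    also have "\<dots> \<longleftrightarrow> (\<forall>x y. z \<bullet> br x y = 0)"
      using nabla_killing[OF br z] by (metis mult_eq_0_iff zero_neq_numeral)
    finally show ?thesis .
  qed
  then show ?thesis
    unfolding strict_killing_vector_def killing_vector_iff_ad_skew[OF br, symmetric] by blast
qed

text \<open>The Hodge dual of the 1-form \<open>z\<^sup>*\<close> is the contraction of the volume form with \<open>z\<close>.\<close>

definition hodge_vector :: "'a::euclidean_space \<Rightarrow> 'a form" where
  "hodge_vector z = interior_product z vol"

lemma is_form_hodge_vector: "is_form (DIM('a) - 1) (hodge_vector (z :: 'a::euclidean_space))"
  unfolding hodge_vector_def
  by (rule is_form_interior_product) (simp add: is_form_vol)

text \<open>Since the volume form is parallel, \<open>\<nabla>\<^sub>x\<close> passes through the contraction to \<open>z\<close>.\<close>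

lemma nabla_form_hodge_vector:
  fixes br :: "'a::euclidean_space \<Rightarrow> 'a \<Rightarrow> 'a"
  assumes br: "lie_bracket br" and len: "length xs = DIM('a) - 1"
  shows "nabla_form br x (hodge_vector z) xs = vol (nabla br x z # xs)"
proof -
  obtain p where p: "DIM('a) = Suc p"
    using DIM_positive by (metis gr0_implies_Suc)
  have "(\<Sum>i<DIM('a). vol ((z # xs)[i := nabla br x ((z # xs) ! i)])) = 0"
    using len p by (intro sum_vol_update_skew nabla_skew[OF br]) simp
  then show ?thesis
    using len
    by (simp add: p sum.lessThan_Suc_shift nabla_form_def hodge_vector_def interior_product_def
        del: sum.lessThan_Suc)
qed

text \<open>The exterior derivative of the Hodge dual of \<open>z\<close> is the divergence of \<open>z\<close> times the
  volume form, and a Killing vector has divergence zero because \<open>x \<mapsto> \<nabla>\<^sub>x z\<close> is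
  skew-symmetric.\<close>

lemma ext_deriv_hodge_killing:
  fixes br :: "'a::euclidean_space \<Rightarrow> 'a \<Rightarrow> 'a"
  assumes br: "lie_bracket br" and z: "killing_vector br z" and len: "length xs = DIM('a)"
  shows "ext_deriv br (hodge_vector z) xs = 0"
proof -
  have "ext_deriv br (hodge_vector z) xs =
      (\<Sum>i<DIM('a). (- 1) ^ i * nabla_form br (xs ! i) (hodge_vector z) (nths xs (- {i})))"
    using ext_deriv_eq_sum_nabla_form[OF br is_form_hodge_vector, of xs z] len by simp
  also have "\<dots> = (\<Sum>i<DIM('a). vol (xs[i := nabla br (xs ! i) z]))"
    using len is_form_Cons_nths[OF is_form_vol len]
    by (intro sum.cong refl)
      (simp add: nabla_form_hodge_vector[OF br] length_nths_Compl_singleton)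
  also have "\<dots> = 0"
    by (rule sum_vol_update_skew[OF nabla_killing_skew[OF br z] len])
  finally show ?thesis .
qed

text \<open>The conformal Killing equation for the Hodge dual. With \<open>B x = \<nabla>\<^sub>x z\<close>, the codifferential
  on \<open>ys\<close> is a sum of terms \<open>vol(B e, e, \<dots>)\<close> over the basis vectors \<open>e\<close>. For each \<open>e\<close>,
  Cramer's rule for the list \<open>e # ys\<close> and the vector \<open>B e\<close> reduces the wedge product with
  \<open>x\<^sup>*\<close> to \<open>(B e \<bullet> x) vol(e, ys) - (e \<bullet> x) vol(B e, ys)\<close>. As \<open>B\<close> is skew-symmetric, both
  parts sum up to \<open>- vol(B x, ys)\<close> over \<open>e\<close>.\<close>

lemma wedge_codiff_hodge_killing:
  fixes br :: "'a::euclidean_space \<Rightarrow> 'a \<Rightarrow> 'a"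
  assumes br: "lie_bracket br" and z: "killing_vector br z" and len: "length ys = DIM('a) - 1"
  shows "wedge_dual x (codiff br (hodge_vector z)) ys = - 2 * vol (nabla br x z # ys)"
proof -
  let ?B = "\<lambda>x. nabla br x z"
  obtain p where p: "DIM('a) = Suc p" "length ys = p"
    using DIM_positive len by (metis gr0_implies_Suc diff_Suc_1)
  have lin: "linear (\<lambda>w. vol (w # ys))"
    using is_form_linear_Cons[OF is_form_vol[where 'a='a, unfolded p(1)] p(2)] .
  have cod: "codiff br (hodge_vector z) (nths ys (- {i})) =
      (\<Sum>e\<in>Basis. (- 1) ^ i * vol (e # ys[i := ?B e]))" if i: "i < p" for i
  proof -
    have "interior_product e (nabla_form br e (hodge_vector z)) (nths ys (- {i})) =
        - ((- 1) ^ i * vol (e # ys[i := ?B e]))" for e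
    proof -
      have "interior_product e (nabla_form br e (hodge_vector z)) (nths ys (- {i})) =
          vol (?B e # nths (e # ys) (- {Suc i}))"
        using i p by (simp add: interior_product_def nths_Compl_Cons
            nabla_form_hodge_vector[OF br] length_nths_Compl_singleton)
      also have "\<dots> = (- 1) ^ Suc i * vol ((e # ys)[Suc i := ?B e])"
        using i p by (intro is_form_Cons_nths[OF is_form_vol]) auto
      finally show ?thesis by simp
    qed
    then show ?thesis
      by (simp add: codiff_def sum_negf)
  qed
  have cramer: "(\<Sum>i<p. (x \<bullet> ys ! i) * vol (e # ys[i := ?B e])) =
      (?B e \<bullet> x) * vol (e # ys) - (e \<bullet> x) * vol (?B e # ys)" for e
    using vol_cramer[of "e # ys" "?B e" x] p
    by (simp add: sum.lessThan_Suc_shift inner_commute mult.commute del: sum.lessThan_Suc)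
  have sq: "(- 1) ^ i * c * ((- 1) ^ i * r) = c * r" for i and c r :: real
    by (cases "even i") auto
  have "wedge_dual x (codiff br (hodge_vector z)) ys =
      (\<Sum>i<p. \<Sum>e\<in>Basis. (x \<bullet> ys ! i) * vol (e # ys[i := ?B e]))"
    unfolding wedge_dual_def p(2)
    by (intro sum.cong refl) (simp add: cod sum_distrib_left sq)
  also have "\<dots> = (\<Sum>e\<in>Basis. \<Sum>i<p. (x \<bullet> ys ! i) * vol (e # ys[i := ?B e]))"
    by (rule sum.swap)
  also have "\<dots> = - (\<Sum>e\<in>Basis. (?B x \<bullet> e) * vol (e # ys)) - (\<Sum>e\<in>Basis. (x \<bullet> e) * vol (?B e # ys))"
  proof -
    have "?B e \<bullet> x = - (?B x \<bullet> e)" for e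
      using nabla_killing_skew[OF br z, of e x] by (simp add: inner_commute[of e])
    then show ?thesis
      by (simp add: cramer sum_subtractf sum_negf inner_commute[of _ x])
  qed
  also have "(\<Sum>e\<in>Basis. (?B x \<bullet> e) * vol (e # ys)) = vol (?B x # ys)"
    by (rule linear_expand_Basis[OF lin, symmetric])
  also have "(\<Sum>e\<in>Basis. (x \<bullet> e) * vol (?B e # ys)) = vol (?B x # ys)"
  proof -
    have "linear (\<lambda>w. vol (?B w # ys))"
      using linear_compose[OF linear_nabla_left[OF lie_bracket_bilinear[OF br]] lin]
      by (simp add: o_def)
    from linear_expand_Basis[OF this, of x] show ?thesis ..
  qed
  finally show ?thesis by simp
qed

text \<open>In degree \<open>d - 1\<close> the coefficient of \<open>x\<^sup>* \<and> d\<^sup>*\<omega>\<close> in the conformal Killing equation is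
  \<open>- 1/2\<close>, which cancels the factor \<open>- 2\<close> just found.\<close>

lemma hodge_killing_star_killing:
  fixes br :: "'a::euclidean_space \<Rightarrow> 'a \<Rightarrow> 'a"
  assumes br: "lie_bracket br" and z: "killing_vector br z"
  shows "star_killing br (DIM('a) - 1) (hodge_vector z)"
proof -
  have d: "real (DIM('a) - 1) = real DIM('a) - 1"
    by (simp add: of_nat_diff Suc_leI)
  have closed: "ext_deriv br (hodge_vector z) xs = 0" if "length xs = Suc (DIM('a) - 1)" for xs
    using ext_deriv_hodge_killing[OF br z] that by simp
  then show ?thesis
    unfolding star_killing_def cky_def
    by (auto simp: is_form_hodge_vector nabla_form_hodge_vector[OF br]
        wedge_codiff_hodge_killing[OF br z] interior_product_def d
        simp del: One_nat_def)
qed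

text \<open>For a closed form the Killing equation says that the form is parallel. The Hodge dual of
  \<open>z\<close> is parallel only if \<open>z\<close> is, the volume form being non-degenerate.\<close>

lemma hodge_strict_killing_strict_cky:
  fixes br :: "'a::euclidean_space \<Rightarrow> 'a \<Rightarrow> 'a"
  assumes br: "lie_bracket br" and z: "strict_killing_vector br z"
  shows "strict_cky br (DIM('a) - 1) (hodge_vector z)"
proof -
  have k: "killing_vector br z"
    using z by (simp add: strict_killing_vector_def)
  obtain x y where "z \<bullet> br x y \<noteq> 0"
    using z unfolding strict_killing_vector_iff[OF br] by blast
  then have "z \<bullet> nabla br x y \<noteq> 0"
    using nabla_killing[OF br k, of x y] by auto
  then have "nabla br x z \<noteq> 0"
    using nabla_skew[OF br, of x z y] by auto
  then obtain xs where xs: "length xs = DIM('a) - 1" "vol (nabla br x z # xs) \<noteq> 0"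
    by (rule vol_nondegenerate)
  have "\<not> ky br (DIM('a) - 1) (hodge_vector z)"
  proof
    assume "ky br (DIM('a) - 1) (hodge_vector z)"
    then have "nabla_form br x (hodge_vector z) xs =
        1 / (real (DIM('a) - 1) + 1) * interior_product x (ext_deriv br (hodge_vector z)) xs"
      using xs(1) by (simp add: ky_def)
    then show False
      using xs ext_deriv_hodge_killing[OF br k, of "x # xs"]
      by (simp add: nabla_form_hodge_vector[OF br] interior_product_def)
  qed
  then show ?thesis
    using hodge_killing_star_killing[OF br k] by (simp add: strict_cky_def star_killing_def)
qed

section \<open>Strict Killing vectors of almost abelian Lie algebras\<close>

text \<open>Write \<open>M = S + A\<close>, so that the derived algebra is the image of \<open>M\<close>. If \<open>z = c e\<^sub>0 + u\<close>
  is Killing, then \<open>ad\<^sub>z\<close> maps \<open>U\<close> to itself, and by skew-symmetry \<open>[z, e\<^sub>0] = - M u\<close> is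
  orthogonal to \<open>U\<close>, hence zero; on \<open>U\<close>, \<open>ad\<^sub>z = c M\<close> is skew-symmetric, that is,
  \<open>c S = 0\<close>. Strictness excludes \<open>S u = 0\<close>: then \<open>A u = 0\<close> too and \<open>u\<close> is orthogonal to
  the image of \<open>M\<close>. With \<open>S u \<noteq> 0\<close> it follows that \<open>c = 0\<close>.

  Conversely a vector \<open>z\<close> of \<open>Ker M\<close> is central, so it is trivially Killing. If moreover
  \<open>S z \<noteq> 0\<close>, then \<open>A z = - S z\<close> and pairing \<open>z\<close> with the element \<open>M (S z)\<close> of the derived
  algebra gives \<open>2 |S z|\<^sup>2 \<noteq> 0\<close>.\<close>

lemma almost_abelian_strict_killing_iff:
  fixes br :: "'a::euclidean_space \<Rightarrow> 'a \<Rightarrow> 'a"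
  assumes aa: "almost_abelian br e\<^sub>0 U (\<lambda>u. S u + A u)"
    and e0: "norm e\<^sub>0 = 1" and orth: "\<forall>u\<in>U. e\<^sub>0 \<bullet> u = 0"
    and S: "symmetric_on U S" and A: "skew_on U A"
  shows "strict_killing_vector br z \<longleftrightarrow>
    z \<in> ker_on U (\<lambda>u. A u + S u) - (ker_on U A \<inter> ker_on U S)"
proof -
  have br: "lie_bracket br" and sub: "subspace U" and spn: "span (insert e\<^sub>0 U) = UNIV"
    and ab: "\<And>u v. u \<in> U \<Longrightarrow> v \<in> U \<Longrightarrow> br u v = 0"
    and ad: "\<And>u. u \<in> U \<Longrightarrow> br e\<^sub>0 u = S u + A u"
    using aa by (auto simp: almost_abelian_def)
  have SU: "S u \<in> U" and AU: "A u \<in> U" if "u \<in> U" for u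
    using S A that by (auto simp: symmetric_on_def skew_on_def endo_on_def)
  have Ssym: "S u \<bullet> v = u \<bullet> S v" and Askew: "A u \<bullet> v = - (u \<bullet> A v)" if "u \<in> U" "v \<in> U" for u v
    using S A that by (auto simp: symmetric_on_def skew_on_def)
  note b = lie_bracket_bilinear[OF br]
  note bi = bilinear_ladd[OF b] bilinear_radd[OF b] bilinear_lmul[OF b] bilinear_rmul[OF b]
    bilinear_lzero[OF b] bilinear_rzero[OF b]
  have alt: "br x x = 0" for x
    using br by (simp add: lie_bracket_def)
  have split: "\<exists>c u. u \<in> U \<and> x = c *\<^sub>R e\<^sub>0 + u" for x
  proof -
    have "x \<in> span (insert e\<^sub>0 U)"
      by (simp add: spn)
    then obtain c where "x - c *\<^sub>R e\<^sub>0 \<in> span U"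
      by (auto simp: span_breakdown_eq)
    moreover have "span U = U"
      using sub by (simp add: span_eq_iff)
    ultimately show ?thesis
      by (intro exI[of _ c] exI[of _ "x - c *\<^sub>R e\<^sub>0"]) auto
  qed
  show ?thesis
  proof
    assume z: "strict_killing_vector br z"
    then have skew: "\<And>x y. br z x \<bullet> y = - (x \<bullet> br z y)" and np: "\<exists>x y. z \<bullet> br x y \<noteq> 0"
      by (auto simp: strict_killing_vector_iff[OF br])
    obtain c u where u: "u \<in> U" "z = c *\<^sub>R e\<^sub>0 + u"
      using split by blast
    have adz: "br z v = c *\<^sub>R (S v + A v)" if "v \<in> U" for v
      using u that by (simp add: bi ab ad)
    have ze: "br z e\<^sub>0 = - (S u + A u)"
      using u lie_bracket_swap[OF br, of e\<^sub>0 u] by (simp add: bi alt ad)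
    have "br z e\<^sub>0 \<bullet> (S u + A u) = 0"
      using skew[of e\<^sub>0 "S u + A u"] orth adz[of "S u + A u"] u(1) SU AU sub
      by (simp add: subspace_add inner_add_right)
    then have Mu: "S u + A u = 0"
      unfolding ze inner_minus_left by simp
    have cS: "c *\<^sub>R S v = 0" if v: "v \<in> U" for v
    proof -
      have "c * (S v \<bullet> w) = 0" if w: "w \<in> U" for w
        using skew[of v w] adz[OF v] adz[OF w] Ssym[OF v w] Askew[OF v w]
        by (simp add: inner_add_left inner_add_right algebra_simps)
      from this[OF SU[OF v]] show ?thesis
        by auto
    qed
    have "S u \<noteq> 0"
    proof
      assume Su: "S u = 0"
      then have Au: "A u = 0"
        using Mu by simp
      have "z \<bullet> br x y = 0" for x y
      proof -
        obtain a v where v: "v \<in> U" "x = a *\<^sub>R e\<^sub>0 + v"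
          using split by blast
        obtain a' v' where v': "v' \<in> U" "y = a' *\<^sub>R e\<^sub>0 + v'"
          using split by blast
        have perp: "z \<bullet> (S w + A w) = 0" if w: "w \<in> U" for w
          using u w orth SU[OF w] AU[OF w] Ssym[OF u(1) w] Askew[OF u(1) w] Su Au
          by (simp add: inner_add_left inner_add_right)
        have "br x y = a *\<^sub>R (S v' + A v') - a' *\<^sub>R (S v + A v)"
          using v v' lie_bracket_swap[OF br, of e\<^sub>0 v] by (simp add: bi alt ad ab)
        then show ?thesis
          by (simp add: inner_diff_right perp[OF v(1)] perp[OF v'(1)])
      qed
      with np show False
        by blast
    qed
    moreover from this cS[OF u(1)] have "c = 0"
      by simp
    ultimately show "z \<in> ker_on U (\<lambda>u. A u + S u) - (ker_on U A \<inter> ker_on U S)"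
      using u Mu by (simp add: ker_on_def add.commute)
  next
    assume "z \<in> ker_on U (\<lambda>u. A u + S u) - (ker_on U A \<inter> ker_on U S)"
    then have zU: "z \<in> U" and Mz: "S z + A z = 0" and Sz: "S z \<noteq> 0"
      by (auto simp: ker_on_def add.commute)
    have central: "br z x = 0" for x
    proof -
      obtain a v where v: "v \<in> U" "x = a *\<^sub>R e\<^sub>0 + v"
        using split by blast
      then show ?thesis
        using zU Mz lie_bracket_swap[OF br, of e\<^sub>0 z] by (simp add: bi ab ad)
    qed
    have "z \<bullet> br e\<^sub>0 (S z) = 2 * (S z \<bullet> S z)"
    proof -
      have "A z = - S z"
        using Mz by (metis add_eq_0_iff)
      then show ?thesis
        using ad[OF SU[OF zU]] Ssym[OF zU SU[OF zU]] Askew[OF zU SU[OF zU]]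
        by (simp add: inner_add_right)
    qed
    then show "strict_killing_vector br z"
      using Sz central unfolding strict_killing_vector_iff[OF br]
      by (metis inner_eq_zero_iff inner_zero_left inner_zero_right mult_eq_0_iff neg_0_equal_iff_equal
          zero_neq_numeral)
  qed
qed

theorem proposition3p10:
  fixes br :: "'a::euclidean_space \<Rightarrow> 'a \<Rightarrow> 'a"
    and e\<^sub>0 :: 'a and U :: "'a set" and S A :: "'a \<Rightarrow> 'a"
  assumes "almost_abelian br e\<^sub>0 U (\<lambda>u. S u + A u)"
    and "norm e\<^sub>0 = 1"
    and "\<forall>u\<in>U. e\<^sub>0 \<bullet> u = 0"
    and "symmetric_on U S"
    and "skew_on U A"
  shows "((\<exists>z. strict_killing_vector br z) \<and>
          (\<exists>\<omega>. strict_cky br (DIM('a) - 1) \<omega> \<and> star_killing br (DIM('a) - 1) \<omega>)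
            \<longleftrightarrow> ker_on U A \<inter> ker_on U S \<subset> ker_on U (\<lambda>u. A u + S u)) \<and>
         (ker_on U A \<inter> ker_on U S \<subset> ker_on U (\<lambda>u. A u + S u) \<longrightarrow>
            (\<forall>z \<in> ker_on U (\<lambda>u. A u + S u) - (ker_on U A \<inter> ker_on U S).
               strict_killing_vector br z))"
proof -
  let ?K = "ker_on U (\<lambda>u. A u + S u)" and ?L = "ker_on U A \<inter> ker_on U S"
  have br: "lie_bracket br"
    using assms(1) by (simp add: almost_abelian_def)
  have strict: "strict_killing_vector br z \<longleftrightarrow> z \<in> ?K - ?L" for z
    by (rule almost_abelian_strict_killing_iff[OF assms])
  have "?L \<subseteq> ?K"
    by (auto simp: ker_on_def)
  then have "?L \<subset> ?K \<longleftrightarrow> (\<exists>z. strict_killing_vector br z)"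
    unfolding strict by blast
  moreover have "\<exists>\<omega>. strict_cky br (DIM('a) - 1) \<omega> \<and> star_killing br (DIM('a) - 1) \<omega>"
    if "strict_killing_vector br z" for z
    using hodge_strict_killing_strict_cky[OF br that] hodge_killing_star_killing[OF br] that
    by (auto simp: strict_killing_vector_def)
  ultimately show ?thesis
    using strict by blast
qed

end
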